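(* Let $0<\alpha<1$, let $\beta\in[0,1]$, and let $j$ be an integer such that $\alpha^{j}<\beta\le\alpha^{j-1}$. Let $P_n$ be the path on $n\ge1$ vertices. If $2\alpha^{j}<\beta$, then $\mathrm{Z}_{\alpha,\beta}(P_n)=\lceil \frac{n}{j}\rceil$, and if $\beta\le2\alpha^{j}$, then $\mathrm{Z}_{\alpha,\beta}(P_n)=\lceil\frac{2n}{2j+1}\rceil$. Furthermore, for $n>j$, there is a minimum (i.e. of cardinality $\mathrm{Z}_{\alpha,\beta}(P_n)$) $(\alpha,\beta)$-transmission zero forcing set of $P_n$ that includes both endpoints of $P_n$.
   Context: All graphs are finite and simple. Let $\alpha,\beta\in[0,1]$ (the transmission proportion and the transmission threshold), let $G$ be a graph and $B\subseteq V(G)$ a set of initially filled vertices. The transmission forcing process started from $B$ is defined as follows. Put $B_0=B$, $w_0(v)=1$ for $v\in B$ and $w_0(v)=0$ for $v\in V(G)\setminus B$. For $t\ge 1$, given the set $B_{t-1}$ of vertices filled at time $t-1$ and the weights $w_{t-1}$: for each unfilled vertex $u\in V(G)\setminus B_{t-1}$ let $\mathcal V_{t,u}$ be the set of all $v\in B_{t-1}$ such that $u$ is the only neighbor of $v$ in $V(G)\setminus B_{t-1}$ and $v\notin \mathcal V_{s,u'}$ for every $s<t$ and every $u'$ (each vertex transmits weight at most once); when $v\in\mathcal V_{t,u}$ we say $v$ forces $u$, written $v\to u$. Set $w_t(u)=w_{t-1}(u)+\sum_{v\in\mathcal V_{t,u}}\alpha\, w_{t-1}(v)$ for $u\in V(G)\setminus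 B_{t-1}$ and $w_t(u)=w_{t-1}(u)$ for $u\in B_{t-1}$. Then $B_t=B_{t-1}\cup\{u\in V(G)\setminus B_{t-1} : w_t(u)\ge\beta\}$. The set $B$ is an $(\alpha,\beta)$-transmission zero forcing set of $G$ if $B_t=V(G)$ for some $t\ge 0$, and the $(\alpha,\beta)$-transmission zero forcing number $\mathrm{Z}_{\alpha,\beta}(G)$ is the minimum cardinality of such a set. *)

theory Defs
  imports Complex_Main "Graph_Theory.Pair_Digraph"
begin

text \<open>
  Finite simple graphs are the symmetric loop-free digraphs of locale \<^locale>\<open>pair_graph\<close>: an
  undirected edge is represented by its two orientations.
\<close>

definition unfilled_neighbors :: "'a pair_pre_digraph \<Rightarrow> 'a set \<Rightarrow> 'a \<Rightarrow> 'a set" where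
  "unfilled_neighbors G F v = {u \<in> pverts G - F. (v, u) \<in> parcs G}"

text \<open>
  \<open>T\<close> is the set of vertices that transmitted at an earlier time.
\<close>

definition forcing_vertices ::
  "'a pair_pre_digraph \<Rightarrow> 'a set \<Rightarrow> 'a set \<Rightarrow> 'a \<Rightarrow> 'a set" where
  "forcing_vertices G F T u = {v \<in> F. unfilled_neighbors G F v = {u} \<and> v \<notin> T}"

text \<open>
  The state after \<open>t\<close> steps is the triple of the filled set, the weights, and the set of
  vertices that have already transmitted. A vertex transmits when it forces some unfilled \<open>u\<close>, even
  if the weight of \<open>u\<close> remains below the threshold \<open>\<beta>\<close>.
\<close>

primrec transmission_state ::
  "'a pair_pre_digraph \<Rightarrow> real \<Rightarrow> real \<Rightarrow> 'a set \<Rightarrow> nat \<Rightarrow> 'a set \<times> ('a \<Rightarrow> real) \<times> 'a set" where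
  "transmission_state G \<alpha> \<beta> B 0 = (B, (\<lambda>v. if v \<in> B then 1 else 0), {})"
| "transmission_state G \<alpha> \<beta> B (Suc t) =
     (case transmission_state G \<alpha> \<beta> B t of (F, w, T) \<Rightarrow>
       let U = pverts G - F;
           w' = (\<lambda>u. if u \<in> U then w u + (\<Sum>v\<in>forcing_vertices G F T u. \<alpha> * w v) else w u)
       in (F \<union> {u \<in> U. w' u \<ge> \<beta>}, w', T \<union> (\<Union>u\<in>U. forcing_vertices G F T u)))"

definition filled_at ::
  "'a pair_pre_digraph \<Rightarrow> real \<Rightarrow> real \<Rightarrow> 'a set \<Rightarrow> nat \<Rightarrow> 'a set" where
  "filled_at G \<alpha> \<beta> B t = fst (transmission_state G \<alpha> \<beta> B t)"

definition transmission_zf_set ::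
  "'a pair_pre_digraph \<Rightarrow> real \<Rightarrow> real \<Rightarrow> 'a set \<Rightarrow> bool" where
  "transmission_zf_set G \<alpha> \<beta> B \<longleftrightarrow> B \<subseteq> pverts G \<and> (\<exists>t. filled_at G \<alpha> \<beta> B t = pverts G)"

definition transmission_zf_number :: "'a pair_pre_digraph \<Rightarrow> real \<Rightarrow> real \<Rightarrow> nat" where
  "transmission_zf_number G \<alpha> \<beta> = Min (card ` {B. transmission_zf_set G \<alpha> \<beta> B})"

definition path_graph :: "nat \<Rightarrow> nat pair_pre_digraph" where
  "path_graph n = \<lparr> pverts = {1..n},
     parcs = {(i, k). i \<in> {1..n} \<and> k \<in> {1..n} \<and> (k = i + 1 \<or> i = k + 1)} \<rparr>"

lemma pair_graph_path_graph: "pair_graph (path_graph n)"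
proof
  show "finite (parcs (path_graph n))"
    by (rule finite_subset[of _ "{1..n} \<times> {1..n}"]) (auto simp: path_graph_def)
qed (auto simp: path_graph_def symmetric_def sym_def)

lemma transmission_zf_set_pverts: "transmission_zf_set G \<alpha> \<beta> (pverts G)"
  unfolding transmission_zf_set_def filled_at_def by (auto intro: exI[of _ 0])

text \<open>
  The minimum in the definition of the transmission zero forcing number ranges over a nonempty
  finite set, so it is attained.
\<close>

lemma (in pair_graph) transmission_zf_number_attained:
  "\<exists>B. transmission_zf_set G \<alpha> \<beta> B \<and> card B = transmission_zf_number G \<alpha> \<beta>"
  and transmission_zf_number_le:
  "transmission_zf_set G \<alpha> \<beta> B \<Longrightarrow> transmission_zf_number G \<alpha> \<beta> \<le> card B"
proof -
  let ?S = "{B. transmission_zf_set G \<alpha> \<beta> B}"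
  have "?S \<subseteq> Pow (pverts G)"
    by (auto simp: transmission_zf_set_def)
  then have fin: "finite (card ` ?S)"
    using pair_finite_verts by (meson finite_Pow_iff finite_imageI finite_subset)
  have ne: "card ` ?S \<noteq> {}"
    using transmission_zf_set_pverts[of G \<alpha> \<beta>] by blast
  show "\<exists>B. transmission_zf_set G \<alpha> \<beta> B \<and> card B = transmission_zf_number G \<alpha> \<beta>"
    using Min_in[OF fin ne] unfolding transmission_zf_number_def by auto
  show "transmission_zf_set G \<alpha> \<beta> B \<Longrightarrow> transmission_zf_number G \<alpha> \<beta> \<le> card B"
    unfolding transmission_zf_number_def using fin by (intro Min_le) auto
qed

end

theory Submission
  imports Defs
begin

text \<open>
  Write \<open>m\<close> for the exponent in \<open>\<alpha> ^ m < \<beta> \<le> \<alpha> ^ (m - 1)\<close>, and put \<open>\<epsilon> = 1\<close> if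
  \<open>\<beta> \<le> 2 * \<alpha> ^ m\<close> and \<open>\<epsilon> = 0\<close> otherwise. Both cases say that the number is the least \<open>k\<close> with
  \<open>2 * n \<le> (2 * m + \<epsilon>) * k\<close>.

  Lower bound: on a graph of maximum degree two, a vertex forced from both sides never transmits, so
  every transmitting vertex carries a weight \<open>\<alpha> ^ d\<close> with \<open>d < m\<close>. Charge it
  \<open>2 * (m - 1 - d) + \<epsilon>\<close>, and other vertices \<open>0\<close>. If everything gets filled, the charges of the
  forcers of an initially unfilled vertex exceed its own charge by at least \<open>2\<close>. Summing, the
  charges of the initial vertices, at most \<open>2 * (m - 1) + \<epsilon>\<close> each, pay \<open>2\<close> for each of the others.

  Upper bound: a set whose gaps obey the bounds reachable from one or both ends fills the path,
  because in a state without further transmissions the leftmost unfilled vertex would have received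
  the full weight of the chain on its left and, in a gap served from both ends, the rightmost
  unfilled vertex of that gap the full weight of the chain on its right.
\<close>

section \<open>Forcing histories and termination of the process\<close>

text \<open>
  Here \<open>f v\<close> is the vertex forced by \<open>v\<close>, and \<open>\<tau>\<close> orders the vertices by their filling time; only
  the consequence that forcing has no cycles matters.
\<close>

locale transmission_history = pair_graph G for G :: "'a pair_pre_digraph" +
  fixes \<alpha> \<beta> :: real and B F T :: "'a set" and w :: "'a \<Rightarrow> real"
    and f :: "'a \<Rightarrow> 'a" and \<tau> :: "'a \<Rightarrow> nat"
  assumes B_F: "B \<subseteq> F" and F_verts: "F \<subseteq> pverts G" and T_F: "T \<subseteq> F"
    and f_arc: "v \<in> T \<Longrightarrow> (v, f v) \<in> parcs G"
    and f_notin_B: "v \<in> T \<Longrightarrow> f v \<notin> B"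
    and f_unfilled: "v \<in> T \<Longrightarrow> unfilled_neighbors G F v \<subseteq> {f v}"
    and f_later: "v \<in> T \<Longrightarrow> \<tau> v < \<tau> (f v)"
    and w_B: "u \<in> B \<Longrightarrow> w u = 1"
    and w_not_B: "u \<notin> B \<Longrightarrow> w u = (\<Sum>v\<in>{v \<in> T. f v = u}. \<alpha> * w v)"
    and w_filled: "u \<in> F \<Longrightarrow> u \<notin> B \<Longrightarrow> \<beta> \<le> w u"
    and w_unfilled: "u \<in> pverts G \<Longrightarrow> u \<notin> F \<Longrightarrow> w u < \<beta>"

text \<open>Only unfilled vertices change weight, whereas every transmitter is filled. Contributions
  recorded earlier therefore keep their value, and a step merely adds new forcers to the sums of the
  unfilled vertices.\<close>

lemma transmission_history_step:
  assumes hist: "transmission_history G \<alpha> \<beta> B F T w f \<tau>"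
    and bound: "\<forall>v\<in>F. \<tau> v \<le> t"
    and state: "transmission_state G \<alpha> \<beta> B t = (F, w, T)"
    and state': "transmission_state G \<alpha> \<beta> B (Suc t) = (F', w', T')"
  shows "\<exists>f' \<tau>'. transmission_history G \<alpha> \<beta> B F' T' w' f' \<tau>' \<and> (\<forall>v\<in>F'. \<tau>' v \<le> Suc t)"
proof -
  interpret transmission_history G \<alpha> \<beta> B F T w f \<tau> by (fact hist)
  define U where "U = pverts G - F"
  have w': "w' = (\<lambda>u. if u \<in> U then w u + (\<Sum>v\<in>forcing_vertices G F T u. \<alpha> * w v) else w u)"
    and F': "F' = F \<union> {u \<in> U. \<beta> \<le> w' u}"
    and T': "T' = T \<union> (\<Union>u\<in>U. forcing_vertices G F T u)"
    using state' unfolding U_def by (auto simp: state Let_def)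
  define f' where "f' v = (if v \<in> T then f v else the_elem (unfilled_neighbors G F v))" for v
  \<comment> \<open>Unfilled vertices carry the current time as a placeholder, later than the time
    of every vertex in \<open>F\<close>; it becomes final once the vertex is filled.\<close>
  define \<tau>' where "\<tau>' v = (if v \<in> F then \<tau> v else Suc t)" for v
  have f'_force: "f' v = u" if "v \<in> forcing_vertices G F T u" for u v
    using that by (auto simp: f'_def forcing_vertices_def)
  have T'_cases: "v \<in> T \<and> f' v = f v \<or>
      v \<notin> T \<and> v \<in> F \<and> f' v \<in> U \<and> unfilled_neighbors G F v = {f' v}" if "v \<in> T'" for v
  proof (cases "v \<in> T")
    case False
    with that obtain u where "u \<in> U" "v \<in> forcing_vertices G F T u"
      unfolding T' by blast
    then show ?thesis
      using f'_force False by (simp add: forcing_vertices_def)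
  qed (simp add: f'_def)
  have f'_T: "f' v = f v" if "v \<in> T" for v
    using that by (simp add: f'_def)
  have T_T': "T \<subseteq> T'"
    by (simp add: T')
  have w'_F: "w' v = w v" if "v \<in> F" for v
    using that by (simp add: w' U_def)
  have T'_F: "T' \<subseteq> F"
    using T'_cases T_F by blast
  have U_B: "u \<notin> B" if "u \<in> U" for u
    using that B_F by (auto simp: U_def)
  have sum_T: "(\<Sum>v\<in>{v \<in> T. f v = u}. \<alpha> * w' v) = (\<Sum>v\<in>{v \<in> T. f v = u}. \<alpha> * w v)" for u
    using T_F w'_F by (intro sum.cong) auto
  have finT: "finite T"
    using T_F F_verts pair_finite_verts by (meson finite_subset)
  have finFo: "finite (forcing_vertices G F T u)" for u
    using F_verts by (intro finite_subset[OF _ pair_finite_verts]) (auto simp: forcing_vertices_def)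
  have hist': "transmission_history G \<alpha> \<beta> B F' T' w' f' \<tau>'"
  proof unfold_locales
    show "B \<subseteq> F'" "F' \<subseteq> pverts G" "T' \<subseteq> F'"
      using B_F F_verts T'_F by (auto simp: F' U_def)
  next
    fix v assume v: "v \<in> T'"
    show "(v, f' v) \<in> parcs G"
      using T'_cases[OF v] f_arc by (auto simp: unfilled_neighbors_def)
    show "f' v \<notin> B"
      using T'_cases[OF v] f_notin_B U_B by auto
    have "unfilled_neighbors G F' v \<subseteq> unfilled_neighbors G F v"
      by (auto simp: unfilled_neighbors_def F')
    then show "unfilled_neighbors G F' v \<subseteq> {f' v}"
      using T'_cases[OF v] f_unfilled by force
    show "\<tau>' v < \<tau>' (f' v)"
      using T'_cases[OF v] f_later[of v] bound T_F
      by (auto simp: \<tau>'_def U_def less_Suc_eq_le)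
  next
    fix u assume "u \<in> B"
    then show "w' u = 1"
      using U_B w_B by (auto simp: w')
  next
    fix u assume u: "u \<notin> B"
    show "w' u = (\<Sum>v\<in>{v \<in> T'. f' v = u}. \<alpha> * w' v)"
    proof (cases "u \<in> U")
      case True
      have "{v \<in> T'. f' v = u} = {v \<in> T. f v = u} \<union> forcing_vertices G F T u"
        using True T'_cases f'_force
        by (fastforce simp: T' f'_def forcing_vertices_def)
      moreover have "{v \<in> T. f v = u} \<inter> forcing_vertices G F T u = {}"
        by (auto simp: forcing_vertices_def)
      ultimately have "(\<Sum>v\<in>{v \<in> T'. f' v = u}. \<alpha> * w' v)
          = (\<Sum>v\<in>{v \<in> T. f v = u}. \<alpha> * w' v) + (\<Sum>v\<in>forcing_vertices G F T u. \<alpha> * w' v)"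
        using finT finFo by (simp add: sum.union_disjoint)
      also have "(\<Sum>v\<in>forcing_vertices G F T u. \<alpha> * w' v)
          = (\<Sum>v\<in>forcing_vertices G F T u. \<alpha> * w v)"
        using w'_F by (intro sum.cong) (auto simp: forcing_vertices_def)
      finally show ?thesis
        using True u w_not_B[OF u] sum_T[of u] by (simp add: w')
    next
      case False
      have "{v \<in> T'. f' v = u} = {v \<in> T. f v = u}"
        using T'_cases False f'_T T_T' by fastforce
      then show ?thesis
        using False w_not_B[OF u] sum_T[of u] by (simp add: w')
    qed
  next
    fix u assume "u \<in> F'" "u \<notin> B"
    then show "\<beta> \<le> w' u"
      using w_filled w'_F by (auto simp: F')
  next
    fix u assume "u \<in> pverts G" "u \<notin> F'"
    then show "w' u < \<beta>"
      by (auto simp: F' U_def)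
  qed
  have "\<forall>v\<in>F'. \<tau>' v \<le> Suc t"
    using bound by (auto simp: \<tau>'_def le_SucI)
  with hist' show ?thesis by blast
qed

lemma transmission_history_exists:
  assumes "pair_graph G" and "B \<subseteq> pverts G" and "0 < \<beta>"
    and "transmission_state G \<alpha> \<beta> B t = (F, w, T)"
  shows "\<exists>f \<tau>. transmission_history G \<alpha> \<beta> B F T w f \<tau> \<and> (\<forall>v\<in>F. \<tau> v \<le> t)"
  using assms(4)
proof (induction t arbitrary: F w T)
  case 0
  interpret pair_graph G by (fact assms(1))
  \<comment> \<open>With \<open>T\<close> empty, \<open>id\<close> and the constant time are
    arbitrary. Positivity of \<beta> puts the initial weight 0 below the threshold.\<close>
  have "transmission_history G \<alpha> \<beta> B F T w id (\<lambda>_. 0)"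
    using 0 assms(2,3) by unfold_locales auto
  then show ?case by auto
next
  case (Suc t)
  obtain F0 w0 T0 where s: "transmission_state G \<alpha> \<beta> B t = (F0, w0, T0)"
    by (metis prod_cases3)
  from Suc.IH[OF s] obtain f \<tau> where
    "transmission_history G \<alpha> \<beta> B F0 T0 w0 f \<tau>" "\<forall>v\<in>F0. \<tau> v \<le> t"
    by blast
  from transmission_history_step[OF this s Suc.prems] show ?case .
qed

text \<open>A step may transmit without filling any vertex, so progress is measured by
  \<open>T\<close> rather than by the filled set. \<open>T\<close> cannot grow strictly forever
  inside a finite vertex set, and a step that leaves it unchanged has no forcing vertices.\<close>

lemma transmission_eventually_stuck:
  assumes G: "pair_graph G" and B: "B \<subseteq> pverts G" and \<beta>: "0 < \<beta>"
  obtains t F w T where "transmission_state G \<alpha> \<beta> B t = (F, w, T)"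
    and "\<And>u. u \<in> pverts G - F \<Longrightarrow> forcing_vertices G F T u = {}"
proof -
  interpret pair_graph G by (fact G)
  define T where "T t = snd (snd (transmission_state G \<alpha> \<beta> B t))" for t
  have T_verts: "T t \<subseteq> pverts G" for t
  proof -
    obtain F w S where s: "transmission_state G \<alpha> \<beta> B t = (F, w, S)"
      by (metis prod_cases3)
    then obtain f \<tau> where "transmission_history G \<alpha> \<beta> B F S w f \<tau>"
      using transmission_history_exists[OF G B \<beta>] by blast
    then interpret transmission_history G \<alpha> \<beta> B F S w f \<tau> .
    show ?thesis using T_F F_verts by (simp add: T_def s)
  qed
  have "\<exists>t. \<not> T t \<subset> T (Suc t)"
  proof (rule ccontr)
    assume "\<not> ?thesis"
    then have "T t \<subset> T (Suc t)" for t by blast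
    then have "card (T t) < card (T (Suc t))" for t
      using T_verts pair_finite_verts by (meson finite_subset psubset_card_mono)
    then have "strict_mono (\<lambda>t. card (T t))"
      by (simp add: strict_mono_Suc_iff)
    then have "t \<le> card (T t)" for t
      by (rule seq_suble)
    then have "Suc (card (pverts G)) \<le> card (T (Suc (card (pverts G))))"
      by blast
    moreover have "card (T (Suc (card (pverts G)))) \<le> card (pverts G)"
      using T_verts pair_finite_verts by (simp add: card_mono)
    ultimately show False by simp
  qed
  then obtain t where t: "\<not> T t \<subset> T (Suc t)" by blast
  obtain F w S where s: "transmission_state G \<alpha> \<beta> B t = (F, w, S)"
    by (metis prod_cases3)
  have "T t = S" "T (Suc t) = S \<union> (\<Union>u\<in>pverts G - F. forcing_vertices G F S u)"
    by (simp_all add: T_def s Let_def)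
  with t have "(\<Union>u\<in>pverts G - F. forcing_vertices G F S u) \<subseteq> S"
    by auto
  moreover have "forcing_vertices G F S u \<inter> S = {}" for u
    by (auto simp: forcing_vertices_def)
  ultimately have "\<And>u. u \<in> pverts G - F \<Longrightarrow> forcing_vertices G F S u = {}"
    by blast
  with s show ?thesis by (rule that)
qed

section \<open>Weights along forcing chains and the charging bound\<close>

context transmission_history
begin

lemma finite_T: "finite T"
  using T_F F_verts by (intro finite_subset[OF _ pair_finite_verts]) blast

lemma forcer_arc: "v \<in> T \<Longrightarrow> f v = u \<Longrightarrow> (u, v) \<in> parcs G"
  using f_arc sym_arcs by (auto simp: symmetric_def sym_def)

lemma forcers_nonempty:
  assumes "0 < \<beta>" "u \<in> F" "u \<notin> B"
  shows "{v \<in> T. f v = u} \<noteq> {}"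
proof
  assume "{v \<in> T. f v = u} = {}"
  with w_not_B[OF assms(3)] have "w u = 0" by (simp only: sum.empty)
  with w_filled[OF assms(2,3)] assms(1) show False by simp
qed

lemma w_nonneg:
  assumes "0 \<le> \<alpha>" "0 \<le> \<beta>" "v \<in> T"
  shows "0 \<le> w v"
proof (cases "v \<in> B")
  case True
  then show ?thesis by (simp add: w_B)
next
  case False
  have "v \<in> F" using T_F assms(3) by blast
  from w_filled[OF this False] assms(2) show ?thesis by linarith
qed

text \<open>One of the at most two neighbors of \<open>u\<close> is \<open>f u\<close>, which cannot
  force \<open>u\<close> in return, since \<tau> would have to increase in both directions. This
  leaves room for a single forcer.\<close>

lemma unique_forcer:
  assumes \<beta>: "0 < \<beta>" and deg: "card {v. (u, v) \<in> parcs G} \<le> 2"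
    and u: "u \<in> T" "u \<notin> B"
  obtains x where "{v \<in> T. f v = u} = {x}"
proof -
  let ?N = "{v. (u, v) \<in> parcs G}" and ?P = "{v \<in> T. f v = u}"
  have "?N \<subseteq> pverts G"
    using in_arcsD2 by blast
  then have fin: "finite ?N"
    using pair_finite_verts finite_subset by blast
  have "f u \<notin> ?P"
    using f_later[of u] f_later[of "f u"] u by auto
  moreover have "f u \<in> ?N"
    using f_arc u by simp
  moreover have "?P \<subseteq> ?N"
    using forcer_arc by auto
  ultimately have "?P \<subset> ?N" by blast
  then have "card ?P < 2"
    using psubset_card_mono[OF fin, of ?P] deg by linarith
  moreover have "?P \<noteq> {}"
    using forcers_nonempty \<beta> u T_F by blast
  then have "card ?P \<noteq> 0"
    using finite_T by simp
  ultimately have "card ?P = 1" by linarith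
  then show ?thesis
    using that by (metis card_1_singletonE)
qed

text \<open>By induction along \<tau>: each transmitter outside \<open>B\<close> inherits \<alpha>
  times the weight of its unique forcer, and being filled keeps the exponent below
  \<open>m\<close>.\<close>

lemma T_weight_power:
  assumes \<alpha>: "0 < \<alpha>" "\<alpha> < 1" and \<beta>: "0 < \<beta>" and m: "0 < m" "\<alpha> ^ m < \<beta>"
    and deg: "\<And>u. card {v. (u, v) \<in> parcs G} \<le> 2" and u: "u \<in> T"
  shows "\<exists>d<m. w u = \<alpha> ^ d"
  using u
proof (induction "\<tau> u" arbitrary: u rule: less_induct)
  case less
  show ?case
  proof (cases "u \<in> B")
    case True
    then show ?thesis
      using m w_B by (intro exI[of _ 0]) simp
  next
    case False
    obtain x where x: "{v \<in> T. f v = u} = {x}"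
      using unique_forcer[OF \<beta> deg less.prems False] by blast
    then have "x \<in> T" "f x = u" by auto
    with less.hyps f_later obtain d where d: "w x = \<alpha> ^ d" by blast
    have "w u = \<alpha> ^ Suc d"
      using w_not_B[OF False] by (simp add: x d)
    moreover have "\<beta> \<le> w u"
      using w_filled False less.prems T_F by blast
    ultimately have "\<alpha> ^ m < \<alpha> ^ Suc d"
      using m by simp
    then have "Suc d < m"
      using \<alpha> by (simp only: power_strict_decreasing_iff)
    then show ?thesis
      using \<open>w u = \<alpha> ^ Suc d\<close> by blast
  qed
qed

lemma forcing_card_bound:
  assumes \<alpha>: "0 < \<alpha>" "\<alpha> < 1" and \<beta>: "0 < \<beta>" and m: "0 < m" "\<alpha> ^ m < \<beta>"
    and \<epsilon>: "\<epsilon> = 0 \<Longrightarrow> 2 * \<alpha> ^ m < \<beta>"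
    and deg: "\<And>u. card {v. (u, v) \<in> parcs G} \<le> 2" and full: "F = pverts G"
  shows "2 * card (pverts G) \<le> (2 * m + \<epsilon>) * card B"
proof -
  have "\<forall>u\<in>T. \<exists>d. d < m \<and> w u = \<alpha> ^ d"
    using T_weight_power[OF \<alpha> \<beta> m deg] by blast
  from bchoice[OF this] obtain d
    where d: "\<And>u. u \<in> T \<Longrightarrow> d u < m" "\<And>u. u \<in> T \<Longrightarrow> w u = \<alpha> ^ d u"
    by blast
  \<comment> \<open>Counted in half vertices, this is what the chain through \<open>u\<close> can
    still fill: \<open>m - 1 - d u\<close> vertices alone and, for \<epsilon> = 1, half of a vertex
    shared with another chain.\<close>
  define c where "c u = (if u \<in> T then 2 * (m - 1 - d u) + \<epsilon> else 0)" for u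
  define P where "P u = {v \<in> T. f v = u}" for u
  let ?V = "pverts G"
  have finV: "finite ?V" and finP: "finite (P u)" for u
    using finite_T by (simp_all add: P_def)
  have BV: "B \<subseteq> ?V"
    using B_F full by simp
  then have finB: "finite B"
    using finV finite_subset by blast
  have charge: "2 + c u \<le> sum c (P u)" if u: "u \<in> ?V" "u \<notin> B" for u
  proof -
    have ne: "P u \<noteq> {}"
      using forcers_nonempty[OF \<beta>] u full by (simp add: P_def)
    have w_u: "w u = (\<Sum>v\<in>P u. \<alpha> * w v)"
      using w_not_B[OF u(2)] by (simp add: P_def)
    have filled: "\<beta> \<le> w u"
      using w_filled u full by simp
    have P_T: "v \<in> T" if "v \<in> P u" for v
      using that by (simp add: P_def)
    show ?thesis
    proof (cases "u \<in> T")
      case True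
      obtain x where x: "P u = {x}"
        using unique_forcer[OF \<beta> deg True u(2)] unfolding P_def by blast
      have "w u = \<alpha> ^ Suc (d x)"
        using w_u x P_T d(2) by simp
      with d(2)[OF True] have "\<alpha> ^ d u = \<alpha> ^ Suc (d x)" by simp
      then have "d u = Suc (d x)"
        using \<alpha> by (simp only: power_inject_exp')
      \<comment> \<open>This bound keeps the subtraction in \<open>c u\<close> from truncating, so
        that the charge really drops by 2 from \<open>x\<close> to \<open>u\<close>.\<close>
      moreover have "d u < m"
        using d(1) True by simp
      ultimately show ?thesis
        using True x P_T by (simp add: c_def)
    next
      case False
      \<comment> \<open>As \<open>c u = 0\<close>, the forcers must supply 2. If \<epsilon> = 0 or
        there is one forcer, some forcer has exponent below \<open>m - 1\<close> and pays 2 alone,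
        since otherwise the weight of \<open>u\<close> would stay below \<beta>. In the remaining
        case there are at least two forcers, each paying at least \<epsilon>, which is at least
        1.\<close>
      show ?thesis
      proof (cases "\<epsilon> = 0 \<or> is_singleton (P u)")
        case True
        have "\<exists>x\<in>P u. Suc (d x) < m"
        proof (rule ccontr)
          assume "\<not> ?thesis"
          then have last: "Suc (d x) = m" if "x \<in> P u" for x
            using d(1)[OF P_T[OF that]] that by auto
          have "w u = (\<Sum>v\<in>P u. \<alpha> ^ m)"
            unfolding w_u using P_T d(2) last by (intro sum.cong) (auto simp flip: power_Suc)
          then have w_u': "w u = of_nat (card (P u)) * \<alpha> ^ m" by simp
          have "{v. (u, v) \<in> parcs G} \<subseteq> ?V"
            using in_arcsD2 by blast
          then have "finite {v. (u, v) \<in> parcs G}"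
            by (rule finite_subset) (rule finV)
          moreover have "P u \<subseteq> {v. (u, v) \<in> parcs G}"
            using forcer_arc by (auto simp: P_def)
          ultimately have "card (P u) \<le> card {v. (u, v) \<in> parcs G}"
            by (rule card_mono)
          also have "\<dots> \<le> 2" by (rule deg)
          finally have "card (P u) \<le> 2" .
          then have "w u \<le> 2 * \<alpha> ^ m"
            unfolding w_u' using \<alpha> by (intro mult_right_mono) auto
          moreover have "w u = \<alpha> ^ m" if "is_singleton (P u)"
            using that w_u' by (simp add: is_singleton_altdef)
          ultimately show False
            using True \<epsilon> m(2) filled by fastforce
        qed
        then obtain x where x: "x \<in> P u" "Suc (d x) < m" by blast
        have "2 \<le> c x"
          using x P_T by (simp add: c_def)
        also have "\<dots> \<le> sum c (P u)"
          using x finP by (intro member_le_sum) auto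
        finally show ?thesis
          using \<open>u \<notin> T\<close> by (simp add: c_def)
      next
        case False
        then have "card (P u) \<noteq> 1"
          by (simp add: is_singleton_altdef)
        moreover have "card (P u) \<noteq> 0"
          using ne finP by simp
        ultimately have "2 \<le> card (P u)" by linarith
        also have "\<dots> = (\<Sum>v\<in>P u. 1)" by simp
        also have "\<dots> \<le> sum c (P u)"
          using False P_T by (intro sum_mono) (auto simp: c_def)
        finally show ?thesis
          using \<open>u \<notin> T\<close> by (simp add: c_def)
      qed
    qed
  qed
  have "2 * card (?V - B) + sum c (?V - B) = (\<Sum>u\<in>?V - B. 2 + c u)"
    by (simp only: sum.distrib sum_constant) simp
  also have "\<dots> \<le> (\<Sum>u\<in>?V - B. sum c (P u))"
    using charge by (intro sum_mono) auto
  \<comment> \<open>Each transmitter forces exactly one vertex, and that vertex lies outside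
    \<open>B\<close>, so the sets \<open>P u\<close> partition \<open>T\<close>.\<close>
  also have "\<dots> = sum c T"
  proof -
    have "f ` T \<subseteq> ?V - B"
      using in_arcsD2[OF f_arc] f_notin_B by blast
    from sum.group[OF finite_T _ this, of c] show ?thesis
      using finV by (simp add: P_def)
  qed
  also have "\<dots> \<le> sum c ?V"
    using T_F full finV by (intro sum_mono2) auto
  also have "\<dots> = sum c (?V - B) + sum c B"
    using sum.subset_diff[OF BV finV] by simp
  finally have "2 * card (?V - B) \<le> sum c B" by simp
  also have "\<dots> \<le> (\<Sum>u\<in>B. 2 * (m - 1) + \<epsilon>)"
    by (intro sum_mono) (auto simp: c_def)
  finally have "2 * card (?V - B) \<le> (2 * (m - 1) + \<epsilon>) * card B"
    by (simp add: mult.commute)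
  moreover have "card (?V - B) + card B = card ?V"
    using BV finV finB by (metis card_Diff_subset card_mono le_add_diff_inverse2)
  \<comment> \<open>Adding \<open>2 * card B\<close> turns \<open>2 * (m - 1)\<close> into
    \<open>2 * m\<close>.\<close>
  ultimately show ?thesis
    using m(1) by (cases m) (auto simp: algebra_simps)
qed

text \<open>The unfilled end \<open>p L\<close> does not transmit. Going down from it, a filled
  interior vertex not forced from ahead must be forced from behind, and then cannot force backwards.
  So weight travels only forwards, losing a factor \<alpha> per step, and in a stuck state the last
  filled vertex has already passed it on. The map \<open>p\<close> stays abstract so that it can run
  along a path in either direction.\<close>

lemma chain_weight:
  assumes \<alpha>: "0 < \<alpha>" and \<beta>: "0 < \<beta>"
    and stuck: "\<And>u. u \<in> pverts G - F \<Longrightarrow> forcing_vertices G F T u = {}"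
    and L: "0 < L" and p_0: "p 0 \<in> B" and p_L: "p L \<in> pverts G" "p L \<notin> F"
    and p_filled: "\<And>i. i < L \<Longrightarrow> p i \<in> F"
    and p_notin_B: "\<And>i. 0 < i \<Longrightarrow> i < L \<Longrightarrow> p i \<notin> B"
    and p_nbrs: "\<And>i. 0 < i \<Longrightarrow> i < L \<Longrightarrow> {v. (p i, v) \<in> parcs G} \<subseteq> {p (i - 1), p (Suc i)}"
    and p_last: "unfilled_neighbors G F (p (L - 1)) = {p L}"
  shows "p (L - 1) \<in> T \<and> f (p (L - 1)) = p L \<and> w (p (L - 1)) = \<alpha> ^ (L - 1)"
proof -
  have sole: "{v \<in> T. f v = p i} = {p (i - 1)}"
    if i: "0 < i" "i < L" and fwd: "\<not> (p (Suc i) \<in> T \<and> f (p (Suc i)) = p i)" for i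
  proof -
    have "{v \<in> T. f v = p i} \<subseteq> {p (i - 1)}"
      using p_nbrs[OF i] forcer_arc fwd by blast
    moreover have "{v \<in> T. f v = p i} \<noteq> {}"
      using forcers_nonempty[OF \<beta>] p_filled p_notin_B i by blast
    ultimately show ?thesis by blast
  qed
  have no_back: "\<not> (p i \<in> T \<and> f (p i) = p (i - 1))" if "0 < i" "i \<le> L" for i
    using that(2,1)
  proof (induction i rule: inc_induct)
    case base
    then show ?case using p_L T_F by auto
  next
    case (step i)
    then have "{v \<in> T. f v = p i} = {p (i - 1)}"
      using sole by simp
    then have "p (i - 1) \<in> T" "f (p (i - 1)) = p i" by auto
    then show ?case
      using f_later[of "p i"] f_later[of "p (i - 1)"] by auto
  qed
  have weight: "w (p i) = \<alpha> ^ i" if "i < L" for i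
    using that
  proof (induction i)
    case 0
    then show ?case using p_0 w_B by simp
  next
    case (Suc i)
    have "{v \<in> T. f v = p (Suc i)} = {p i}"
      using sole[of "Suc i"] no_back[of "Suc (Suc i)"] Suc.prems by simp
    then show ?case
      using w_not_B[OF p_notin_B[of "Suc i"]] Suc by simp
  qed
  have "p (L - 1) \<in> T"
  proof (rule ccontr)
    assume "p (L - 1) \<notin> T"
    then have "p (L - 1) \<in> forcing_vertices G F T (p L)"
      using p_last p_filled L by (simp add: forcing_vertices_def)
    then show False using stuck p_L by blast
  qed
  then show ?thesis
    using f_unfilled p_last weight L by force
qed

end

section \<open>Well-spaced sets fill the path\<close>

text \<open>
  The filled vertices \<open>b\<close> and \<open>b'\<close> bounding a gap either let \<open>b\<close> fill the whole gap on its own, or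
  cooperate, in which case \<open>b'\<close> must not depend on the gap to its right.
\<close>

definition well_spaced :: "nat \<Rightarrow> nat \<Rightarrow> nat \<Rightarrow> nat set \<Rightarrow> bool" where
  "well_spaced m \<epsilon> n B \<longleftrightarrow> B \<subseteq> {1..n} \<and> 1 \<in> B \<and>
     (\<forall>b\<in>B. n < b + m \<or> (\<exists>b'\<in>B. b < b' \<and> {b<..<b'} \<inter> B = {} \<and>
        (b' \<le> b + m \<or> b' + 1 \<le> b + 2 * m + \<epsilon> \<and> (b' = n \<or> b' + 1 \<in> B))))"

lemma path_graph_neighbors:
  "{v. (u, v) \<in> parcs (path_graph n)} \<subseteq> {u - 1, Suc u}"
  by (auto simp: path_graph_def)

lemma path_graph_degree: "card {v. (u, v) \<in> parcs (path_graph n)} \<le> 2"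
proof -
  have "card {v. (u, v) \<in> parcs (path_graph n)} \<le> card {u - 1, Suc u}"
    using path_graph_neighbors by (intro card_mono) auto
  also have "\<dots> = 2" by simp
  finally show ?thesis .
qed

lemma path_unfilled_neighbors:
  "unfilled_neighbors (path_graph n) F v = {u \<in> {1..n} - F. v \<in> {1..n} \<and> (u = v + 1 \<or> v = u + 1)}"
  by (auto simp: unfilled_neighbors_def path_graph_def)

lemma well_spaced_transmission_zf_set:
  assumes \<alpha>: "0 < \<alpha>" "\<alpha> < 1" and \<beta>: "0 < \<beta>" and m: "0 < m" "\<beta> \<le> \<alpha> ^ (m - 1)"
    and \<epsilon>: "\<epsilon> = 0 \<or> \<epsilon> = 1 \<and> \<beta> \<le> 2 * \<alpha> ^ m" and B: "well_spaced m \<epsilon> n B"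
  shows "transmission_zf_set (path_graph n) \<alpha> \<beta> B"
proof -
  let ?G = "path_graph n"
  have verts: "pverts ?G = {1..n}"
    by (simp add: path_graph_def)
  have BV: "B \<subseteq> pverts ?G" and "1 \<in> B"
    using B by (auto simp: well_spaced_def verts)
  obtain t F w T where s: "transmission_state ?G \<alpha> \<beta> B t = (F, w, T)"
    and stuck: "\<And>u. u \<in> pverts ?G - F \<Longrightarrow> forcing_vertices ?G F T u = {}"
    using transmission_eventually_stuck[OF pair_graph_path_graph BV \<beta>] by metis
  obtain f \<tau> where "transmission_history ?G \<alpha> \<beta> B F T w f \<tau>"
    using transmission_history_exists[OF pair_graph_path_graph BV \<beta> s] by blast
  then interpret transmission_history ?G \<alpha> \<beta> B F T w f \<tau> .
  have long: "m \<le> L" if "\<alpha> ^ L < \<beta>" for L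
  proof -
    have "\<alpha> ^ L < \<alpha> ^ (m - 1)"
      using that m by linarith
    then have "m - 1 < L"
      using \<alpha> by (simp only: power_strict_decreasing_iff)
    then show ?thesis by linarith
  qed
  \<comment> \<open>Knowing some forcers of an unfilled vertex is enough: the others contribute
    nonnegative weight, and the total is below \<beta>.\<close>
  have partial_weight_less: "(\<Sum>v\<in>Q. \<alpha> * w v) < \<beta>"
    if "Q \<subseteq> {v \<in> T. f v = u}" "u \<in> {1..n}" "u \<notin> F" for u Q
  proof -
    have "(\<Sum>v\<in>Q. \<alpha> * w v) \<le> (\<Sum>v\<in>{v \<in> T. f v = u}. \<alpha> * w v)"
      using that(1) finite_T w_nonneg \<alpha> \<beta> by (intro sum_mono2) auto
    also have "\<dots> = w u"
      by (rule w_not_B[symmetric]) (use B_F that(3) in blast)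
    also have "\<dots> < \<beta>"
      using w_unfilled that by (simp add: verts)
    finally show ?thesis .
  qed
  have "F = {1..n}"
  proof (rule ccontr)
    assume "F \<noteq> {1..n}"
    then have "\<exists>u. u \<in> {1..n} - F"
      using F_verts verts by auto
    define u where "u = (LEAST u. u \<in> {1..n} - F)"
    have u: "u \<in> {1..n}" "u \<notin> F"
      using LeastI_ex[OF \<open>\<exists>u. u \<in> {1..n} - F\<close>] by (auto simp: u_def)
    have below: "v \<in> F" if "1 \<le> v" "v < u" for v
      using not_less_Least[of v "\<lambda>u. u \<in> {1..n} - F"] that u by (auto simp: u_def)
    have "1 < u"
      using u \<open>1 \<in> B\<close> B_F by (metis atLeastAtMost_iff nat_less_le subsetD)
    define b where "b = Max (B \<inter> {..<u})"
    have "b \<in> B \<inter> {..<u}"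
      unfolding b_def using \<open>1 < u\<close> \<open>1 \<in> B\<close> by (intro Max_in) auto
    then have b: "b \<in> B" "b < u" by auto
    have b_max: "v \<le> b" if "v \<in> B" "v < u" for v
      unfolding b_def using that by (intro Max_ge) auto
    have "1 \<le> b"
      using b BV verts by auto
    let ?L = "u - b"
    have left: "b + (?L - 1) \<in> T \<and> f (b + (?L - 1)) = b + ?L \<and> w (b + (?L - 1)) = \<alpha> ^ (?L - 1)"
    proof (rule chain_weight[OF \<alpha>(1) \<beta> stuck, where p = "\<lambda>i. b + i"])
      show "unfilled_neighbors ?G F (b + (?L - 1)) = {b + ?L}"
        using u b \<open>1 \<le> b\<close> below by (force simp: path_unfilled_neighbors)
    next
      fix i assume "0 < i" "i < ?L"
      then show "{v. (b + i, v) \<in> parcs ?G} \<subseteq> {b + (i - 1), b + Suc i}"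
        using path_graph_neighbors[of "b + i" n] by auto
      have "b + i < u" using \<open>i < ?L\<close> by simp
      with b_max[of "b + i"] \<open>0 < i\<close> show "b + i \<notin> B" by auto
    qed (use b u below \<open>1 \<le> b\<close> verts in auto)
    then have left: "u - 1 \<in> T" "f (u - 1) = u" "w (u - 1) = \<alpha> ^ (?L - 1)"
      using b by auto
    have left_w: "\<alpha> * w (u - 1) = \<alpha> ^ ?L"
      using left(3) b by (simp flip: power_Suc add: Suc_diff_Suc)
    have "\<alpha> ^ ?L < \<beta>"
      using partial_weight_less[of "{u - 1}" u] u left left_w by simp
    \<comment> \<open>The chain from \<open>b\<close> alone would have filled every vertex at
      distance less than \<open>m\<close>. This excludes both alternatives of
      \<open>well_spaced\<close> in which \<open>b\<close> serves the gap by itself.\<close>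
    then have mL: "m \<le> ?L"
      using long b by simp
    then have "\<not> n < b + m"
      using u b by auto
    then obtain b' where b': "b' \<in> B" "b < b'" "{b<..<b'} \<inter> B = {}"
      and b'_cases: "b' \<le> b + m \<or> b' + 1 \<le> b + 2 * m + \<epsilon> \<and> (b' = n \<or> b' + 1 \<in> B)"
      using B b(1) unfolding well_spaced_def by blast
    have "u < b'"
      using b_max[of b'] b' u B_F by (metis leD linorder_neqE_nat subsetD)
    then have "\<not> b' \<le> b + m"
      using mL b by linarith
    then have gap: "b' + 1 \<le> b + 2 * m + \<epsilon>" and right_end: "b' = n \<or> b' + 1 \<in> B"
      using b'_cases by auto
    have "b' \<le> n"
      using b' BV verts by auto
    define u' where "u' = Max ({u..<b'} - F)"
    have "u' \<in> {u..<b'} - F"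
      unfolding u'_def using u \<open>u < b'\<close> by (intro Max_in) auto
    then have u': "u \<le> u'" "u' < b'" "u' \<notin> F" by auto
    have above: "v \<in> F" if "u' < v" "v < b'" for v
    proof (rule ccontr)
      assume "v \<notin> F"
      then have "v \<le> u'"
        unfolding u'_def using that u' by (intro Max_ge) auto
      with that show False by simp
    qed
    let ?R = "b' - u'"
    \<comment> \<open>This matters when \<open>u' + 1 = b'\<close>: the transmitter is then
      \<open>b'\<close> itself, whose right neighbor, if there is one, must be filled
      already.\<close>
    have beyond: "b' = n \<or> b' + 1 \<in> F"
      using right_end B_F by auto
    have right: "b' - (?R - 1) \<in> T \<and> f (b' - (?R - 1)) = b' - ?R \<and> w (b' - (?R - 1)) = \<alpha> ^ (?R - 1)"
    proof (rule chain_weight[OF \<alpha>(1) \<beta> stuck, where p = "\<lambda>i. b' - i"])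
      have "b' - (?R - 1) = Suc u'" "b' - ?R = u'"
        using u' by auto
      moreover have "Suc (Suc u') \<in> F \<or> n < Suc (Suc u')"
        using above[of "Suc (Suc u')"] beyond u' b' B_F \<open>b' \<le> n\<close>
        by (metis Suc_eq_plus1 Suc_lessI lessI less_Suc_eq subsetD)
      ultimately show "unfilled_neighbors ?G F (b' - (?R - 1)) = {b' - ?R}"
        using u' u \<open>b' \<le> n\<close> by (auto simp: path_unfilled_neighbors)
    next
      fix i assume i: "0 < i" "i < ?R"
      show "{v. (b' - i, v) \<in> parcs ?G} \<subseteq> {b' - (i - 1), b' - Suc i}"
        using path_graph_neighbors[of "b' - i" n] i by auto
      show "b' - i \<notin> B"
        using b'(3) i u' b by (auto simp: disjoint_iff)
    next
      fix i assume i: "i < ?R"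
      show "b' - i \<in> F"
        using i b' B_F above[of "b' - i"] u' by (cases "i = 0") auto
    qed (use b' u u' \<open>b' \<le> n\<close> verts in auto)
    moreover have "b' - (?R - 1) = Suc u'" "b' - ?R = u'"
      using u' by auto
    ultimately have right: "Suc u' \<in> T" "f (Suc u') = u'" "w (Suc u') = \<alpha> ^ (?R - 1)"
      by auto
    have right_w: "\<alpha> * w (Suc u') = \<alpha> ^ ?R"
      using right(3) u' by (simp flip: power_Suc add: Suc_diff_Suc)
    have "\<alpha> ^ ?R < \<beta>"
      using partial_weight_less[of "{Suc u'}" u'] u u' \<open>b' \<le> n\<close> right right_w by simp
    then have mR: "m \<le> ?R"
      using long u' by simp
    \<comment> \<open>The distance from \<open>b\<close> to \<open>b'\<close> is
      \<open>?L + (u' - u) + ?R\<close>, at least \<open>2 * m\<close>, while \<open>gap\<close>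
      allows at most \<open>2 * m + \<epsilon> - 1\<close>. Hence equality holds throughout, and the
      single vertex \<open>u\<close> receives \<alpha> ^ m from both sides.\<close>
    have "\<epsilon> = 1" "u' = u" "?L = m" "?R = m"
      using mL mR gap \<epsilon> u' b by auto
    moreover have "u - 1 \<noteq> Suc u" by simp
    ultimately have "\<alpha> ^ m + \<alpha> ^ m < \<beta>"
      using partial_weight_less[of "{u - 1, Suc u}" u] u left(1,2) right(1,2) left_w right_w by simp
    then show False
      using \<epsilon> \<open>\<epsilon> = 1\<close> by simp
  qed
  then show ?thesis
    using BV s verts unfolding transmission_zf_set_def filled_at_def by (metis fst_conv)
qed

section \<open>Construction of well-spaced sets of minimum size\<close>

text \<open>Placing \<open>n' + 1\<close> next to \<open>n'\<close> seals off the old path, since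
  the clause \<open>b' = n'\<close> becomes \<open>b' + 1 \<in> B\<close>. The new gap from
  \<open>n' + 1\<close> to the endpoint \<open>n\<close> is served from both sides.\<close>

lemma well_spaced_append:
  assumes B: "well_spaced m \<epsilon> n' B" and n': "n' \<in> B"
    and n: "n' + 2 \<le> n" "n \<le> n' + 2 * m + \<epsilon>" and m: "0 < m"
  shows "well_spaced m \<epsilon> n (B \<union> {n' + 1, n})"
  unfolding well_spaced_def
proof (intro conjI ballI)
  have BV: "B \<subseteq> {1..n'}" and "1 \<in> B"
    using B by (auto simp: well_spaced_def)
  then show "B \<union> {n' + 1, n} \<subseteq> {1..n}" "1 \<in> B \<union> {n' + 1, n}"
    using n by auto
  fix b assume "b \<in> B \<union> {n' + 1, n}"
  then consider "b \<in> B" "b \<noteq> n'" | "b = n'" | "b = n' + 1" | "b = n" by auto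
  then show "n < b + m \<or> (\<exists>b'\<in>B \<union> {n' + 1, n}. b < b' \<and> {b<..<b'} \<inter> (B \<union> {n' + 1, n}) = {} \<and>
      (b' \<le> b + m \<or> b' + 1 \<le> b + 2 * m + \<epsilon> \<and> (b' = n \<or> b' + 1 \<in> B \<union> {n' + 1, n})))"
  proof cases
    case 1
    have "\<exists>b'\<in>B. b < b' \<and> {b<..<b'} \<inter> B = {} \<and>
        (b' \<le> b + m \<or> b' + 1 \<le> b + 2 * m + \<epsilon> \<and> (b' = n' \<or> b' + 1 \<in> B))"
    \<comment> \<open>A vertex \<open>b\<close> that reached the end of the old path alone may have
      had no chosen successor in \<open>well_spaced\<close>; the next element of \<open>B\<close> is
      then within distance \<open>m\<close>.\<close>
    proof (cases "n' < b + m")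
      case True
      define b' where "b' = Min (B \<inter> {b<..})"
      have fin: "finite (B \<inter> {b<..})"
        using BV by (auto intro: finite_subset)
      have "b < n'" using 1 BV by (auto simp: le_neq_implies_less)
      then have "b' \<in> B \<inter> {b<..}"
        unfolding b'_def using fin n' by (intro Min_in) auto
      moreover have "b' \<le> v" if "v \<in> B" "b < v" for v
        unfolding b'_def using fin that by (intro Min_le) auto
      ultimately show ?thesis
        using BV True by (intro bexI[of _ b']) (fastforce)+
    next
      case False
      then show ?thesis using B 1 unfolding well_spaced_def by blast
    qed
    then obtain b' where "b' \<in> B" "b < b'" "{b<..<b'} \<inter> B = {}"
      "b' \<le> b + m \<or> b' + 1 \<le> b + 2 * m + \<epsilon> \<and> (b' = n' \<or> b' + 1 \<in> B)" by blast
    moreover have "b' \<le> n'" using \<open>b' \<in> B\<close> BV by auto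
    ultimately show ?thesis
      using n by (intro disjI2 bexI[of _ b']) auto
  next
    case 2
    then show ?thesis
      using m by (intro disjI2 bexI[of _ "n' + 1"]) auto
  next
    case 3
    have "{n' + 1<..<n} \<inter> (B \<union> {n' + 1, n}) = {}"
      using BV by fastforce
    then show ?thesis
      using 3 n by (intro disjI2 bexI[of _ n]) auto
  next
    case 4
    then show ?thesis using m by simp
  qed
qed

text \<open>Two initial vertices account for a block of \<open>2 * m + \<epsilon>\<close> vertices,
  so \<open>k\<close> drops by 2 as such a block is removed. The recursion stops at 2 and 3, because
  appending needs the last vertex in the set, which \<open>{1}\<close> does not provide in general.
  For \<open>k = 3\<close>, vertex 1 serves its gap alone and the other two share theirs.\<close>

lemma well_spaced_exists:
  assumes m: "0 < m" and \<epsilon>: "\<epsilon> \<le> 1" and n: "0 < n"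
    and k: "(k - 1) * (2 * m + \<epsilon>) < 2 * n" "2 * n \<le> k * (2 * m + \<epsilon>)"
  shows "\<exists>B. well_spaced m \<epsilon> n B \<and> card B = k \<and> (m < n \<longrightarrow> n \<in> B)"
  using n k
proof (induction k arbitrary: n rule: less_induct)
  case (less k)
  consider "k = 0" | "k = 1" | "k = 2" | "k = 3" | "4 \<le> k" by linarith
  then show ?case
  proof cases
    case 1
    then show ?thesis using less.prems by simp
  next
    case 2
    then have "n \<le> m" using less.prems \<epsilon> by simp
    then show ?thesis
      using 2 less.prems by (intro exI[of _ "{1}"]) (auto simp: well_spaced_def)
  next
    case 3
    then have n: "m < n" "n \<le> 2 * m + \<epsilon>" using less.prems by auto
    then have "well_spaced m \<epsilon> n {1, n}"
      using m unfolding well_spaced_def by auto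
    then show ?thesis
      using 3 n m by (intro exI[of _ "{1, n}"]) auto
  next
    case 4
    then have n: "2 * m + \<epsilon> < n" "n \<le> 3 * m + \<epsilon>" using less.prems \<epsilon> by auto
    have "{Suc 0<..<m + 1} \<inter> {1, m + 1, n} = {}" "{m + 1<..<n} \<inter> {1, m + 1, n} = {}"
      using n by auto
    then have "well_spaced m \<epsilon> n {1, m + 1, n}"
      using m n unfolding well_spaced_def by auto
    then show ?thesis
      using 4 n m by (intro exI[of _ "{1, m + 1, n}"]) auto
  next
    case 5
    define M where "M = 2 * m + \<epsilon>"
    have "2 \<le> M" using m by (simp add: M_def)
    obtain l where l: "k = l + 4" using 5 by (metis add.commute le_Suc_ex)
    define n' where "n' = n - M"
    have n_bounds: "(l + 3) * M < 2 * n" "2 * n \<le> (l + 4) * M"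
      using less.prems unfolding l M_def by (simp_all add: add.commute)
    then have "n = n' + M"
      using \<open>2 \<le> M\<close> by (simp add: n'_def algebra_simps)
    with n_bounds have n': "(l + 1) * M < 2 * n'" "2 * n' \<le> (l + 2) * M"
      by (simp_all add: algebra_simps)
    then have "M < 2 * n'" by (simp add: algebra_simps)
    then have "m < n'" by (simp add: M_def)
    have "\<exists>B. well_spaced m \<epsilon> n' B \<and> card B = l + 2 \<and> (m < n' \<longrightarrow> n' \<in> B)"
      using less.IH[of "l + 2" n'] n' \<open>m < n'\<close> by (simp add: l M_def)
    then obtain B where B: "well_spaced m \<epsilon> n' B" "card B = l + 2" "n' \<in> B"
      using \<open>m < n'\<close> by blast
    have "well_spaced m \<epsilon> n (B \<union> {n' + 1, n})"
      using well_spaced_append[OF B(1,3) _ _ m] \<open>n = n' + M\<close> \<open>2 \<le> M\<close> by (simp add: M_def)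
    moreover have "B \<subseteq> {1..n'}"
      using B(1) by (simp add: well_spaced_def)
    then have "card (B \<union> {n' + 1, n}) = card B + card {n' + 1, n}"
      using \<open>n = n' + M\<close> \<open>2 \<le> M\<close> by (intro card_Un_disjoint) (auto intro: finite_subset)
    then have "card (B \<union> {n' + 1, n}) = k"
      using \<open>n = n' + M\<close> \<open>2 \<le> M\<close> B(2) l by simp
    ultimately show ?thesis
      by (intro exI[of _ "B \<union> {n' + 1, n}"]) auto
  qed
qed

section \<open>The transmission zero forcing number of a path\<close>

lemma path_transmission_zf_number:
  assumes \<alpha>: "0 < \<alpha>" "\<alpha> < 1" and m: "0 < m" "\<alpha> ^ m < \<beta>" "\<beta> \<le> \<alpha> ^ (m - 1)" and n: "0 < n"
    and \<epsilon>: "\<epsilon> = 0 \<and> 2 * \<alpha> ^ m < \<beta> \<or> \<epsilon> = 1 \<and> \<beta> \<le> 2 * \<alpha> ^ m"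
  shows "int (transmission_zf_number (path_graph n) \<alpha> \<beta>) = \<lceil>2 * real n / real (2 * m + \<epsilon>)\<rceil>"
    and "m < n \<Longrightarrow> \<exists>B. transmission_zf_set (path_graph n) \<alpha> \<beta> B \<and>
           card B = transmission_zf_number (path_graph n) \<alpha> \<beta> \<and> 1 \<in> B \<and> n \<in> B"
proof -
  interpret pair_graph "path_graph n" by (rule pair_graph_path_graph)
  have \<beta>: "0 < \<beta>"
    using \<alpha> m(2) by (meson less_trans zero_less_power)
  define M where "M = 2 * m + \<epsilon>"
  have "0 < M" using m by (simp add: M_def)
  have lower: "2 * n \<le> M * card B" if zf: "transmission_zf_set (path_graph n) \<alpha> \<beta> B" for B
  proof -
    obtain t where BV: "B \<subseteq> pverts (path_graph n)"
      and t: "filled_at (path_graph n) \<alpha> \<beta> B t = pverts (path_graph n)"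
      using zf by (auto simp: transmission_zf_set_def)
    obtain F w T where s: "transmission_state (path_graph n) \<alpha> \<beta> B t = (F, w, T)"
      by (metis prod_cases3)
    have F: "F = pverts (path_graph n)"
      using t by (simp add: filled_at_def s)
    obtain f \<tau> where "transmission_history (path_graph n) \<alpha> \<beta> B F T w f \<tau>"
      using transmission_history_exists[OF pair_graph_path_graph BV \<beta> s] by blast
    from transmission_history.forcing_card_bound[OF this \<alpha> \<beta> m(1,2) _ path_graph_degree F, of \<epsilon>]
    show ?thesis
      using \<epsilon> by (auto simp: M_def path_graph_def)
  qed
  define k where "k = nat \<lceil>2 * real n / real M\<rceil>"
  have "0 < 2 * real n / real M"
    using n \<open>0 < M\<close> by simp
  then have k_int: "int k = \<lceil>2 * real n / real M\<rceil>"
    by (simp add: k_def)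
  then have "2 * real n / real M \<le> real k" "real k - 1 < 2 * real n / real M"
    by linarith+
  then have k_real: "2 * real n \<le> real k * real M" "(real k - 1) * real M < 2 * real n"
    using \<open>0 < M\<close> by (simp_all add: field_simps)
  have "0 < k"
    using k_real(1) n by (cases k) auto
  then have "real ((k - 1) * M) < real (2 * n)" "real (2 * n) \<le> real (k * M)"
    using k_real by (simp_all add: of_nat_diff)
  then have k: "(k - 1) * M < 2 * n" "2 * n \<le> k * M"
    by (simp_all only: of_nat_less_iff of_nat_le_iff)
  obtain B where B: "well_spaced m \<epsilon> n B" "card B = k" "m < n \<longrightarrow> n \<in> B"
    using well_spaced_exists[OF m(1) _ n, of \<epsilon> k] k \<epsilon> unfolding M_def by auto
  have zf: "transmission_zf_set (path_graph n) \<alpha> \<beta> B"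
    using well_spaced_transmission_zf_set[OF \<alpha> \<beta> m(1,3) _ B(1)] \<epsilon> by blast
  have num: "transmission_zf_number (path_graph n) \<alpha> \<beta> = k"
  proof (rule antisym)
    show "transmission_zf_number (path_graph n) \<alpha> \<beta> \<le> k"
      using transmission_zf_number_le[OF zf] B(2) by simp
    obtain B' where "transmission_zf_set (path_graph n) \<alpha> \<beta> B'"
      and B': "card B' = transmission_zf_number (path_graph n) \<alpha> \<beta>"
      using transmission_zf_number_attained by blast
    then have "2 * n \<le> M * card B'"
      using lower by blast
    \<comment> \<open>Here \<open>k\<close> is the least number satisfying the lower bound, so any
      smaller set would contradict \<open>k(1)\<close>.\<close>
    with k(1) have "(k - 1) * M < card B' * M"
      by (metis less_le_trans mult.commute)
    then show "k \<le> transmission_zf_number (path_graph n) \<alpha> \<beta>"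
      using B' \<open>0 < k\<close> by auto
  qed
  show "int (transmission_zf_number (path_graph n) \<alpha> \<beta>) = \<lceil>2 * real n / real (2 * m + \<epsilon>)\<rceil>"
    using num k_int by (simp add: M_def)
  assume "m < n"
  with B zf num show "\<exists>B. transmission_zf_set (path_graph n) \<alpha> \<beta> B \<and>
      card B = transmission_zf_number (path_graph n) \<alpha> \<beta> \<and> 1 \<in> B \<and> n \<in> B"
    by (auto simp: well_spaced_def)
qed

theorem theorem4p2p1:
  fixes \<alpha> \<beta> :: real and j :: int and n :: nat
  assumes "0 < \<alpha>" and "\<alpha> < 1"
    and "0 \<le> \<beta>" and "\<beta> \<le> 1"
    and "\<alpha> powi j < \<beta>" and "\<beta> \<le> \<alpha> powi (j - 1)"
    and "n \<ge> 1"
  shows "(2 * \<alpha> powi j < \<beta> \<longrightarrow>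
            int (transmission_zf_number (path_graph n) \<alpha> \<beta>) = \<lceil>real n / real_of_int j\<rceil>) \<and>
         (\<beta> \<le> 2 * \<alpha> powi j \<longrightarrow>
            int (transmission_zf_number (path_graph n) \<alpha> \<beta>)
              = \<lceil>2 * real n / (2 * real_of_int j + 1)\<rceil>) \<and>
         (int n > j \<longrightarrow>
            (\<exists>B. transmission_zf_set (path_graph n) \<alpha> \<beta> B \<and>
                 card B = transmission_zf_number (path_graph n) \<alpha> \<beta> \<and>
                 1 \<in> B \<and> n \<in> B))"
proof -
  \<comment> \<open>For \<open>j \<le> 0\<close> the power would be at least 1, hence at least
    \<beta>. Thus \<open>j\<close> may be replaced by a positive natural exponent.\<close>
  have "0 < j"
  proof (rule ccontr)
    assume "\<not> 0 < j"
    then have "\<alpha> powi j = inverse \<alpha> ^ nat (- j)"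
      by (auto simp: power_int_def)
    moreover have "1 \<le> inverse \<alpha> ^ nat (- j)"
      using assms(1,2) by (intro one_le_power) (simp add: one_le_inverse)
    ultimately show False using assms(4,5) by linarith
  qed
  then obtain m where j: "j = int m" and m: "0 < m"
    by (metis of_nat_0_less_iff zero_less_imp_eq_int)
  have powi: "\<alpha> powi j = \<alpha> ^ m" "\<alpha> powi (j - 1) = \<alpha> ^ (m - 1)"
    using m by (simp_all add: j power_int_def nat_diff_distrib')
  note path = path_transmission_zf_number[OF assms(1,2) m, of \<beta> n]
  show ?thesis
  \<comment> \<open>For \<epsilon> = 0 the factor 2 cancels and leaves \<open>n / j\<close>; for
    \<epsilon> = 1 the denominator is \<open>2 * j + 1\<close>.\<close>
  proof (cases "2 * \<alpha> ^ m < \<beta>")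
    case True
    then show ?thesis
      using path[of 0] assms(5-7) powi by (simp add: j)
  next
    case False
    then show ?thesis
      using path[of 1] assms(5-7) powi by (simp add: j add.commute)
  qed
qed

end
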